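(* There does not exist a group law $*$ on the set $\mathbb{R}^{+}$ of positive real numbers that is compatible with the arithmetic-geometric mean, i.e. there is no binary operation $*$ on $\mathbb{R}^{+}$ making $(\mathbb{R}^{+},* )$ a group and satisfying $\operatorname{agm}(x,y)*\operatorname{agm}(x,y)=x*y$ for all $x,y\in\mathbb{R}^{+}$.
   Context: For positive real numbers $x,y$, the arithmetic-geometric mean $\operatorname{agm}(x,y)$ is the common limit of the sequences $(x_n)$ and $(y_n)$ defined by $x_0=x$, $y_0=y$, $x_n=\frac{x_{n-1}+y_{n-1}}{2}$, $y_n=\sqrt{x_{n-1}y_{n-1}}$ for $n\ge 1$. A binary mean operation $m$ and a binary operation $*$ on a set $S$ are called compatible if $m(x,y)*m(x,y)=x*y$ for all $x,y\in S$. The group law $*$ is arbitrary: its identity element may be any element of $\mathbb{R}^{+}$, and it need not be related to the usual operations or topology on $\mathbb{R}^{+}$. *)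

theory Defs
  imports Complex_Main "HOL-Algebra.Group"
begin

fun agm_seq :: "real \<Rightarrow> real \<Rightarrow> nat \<Rightarrow> real \<times> real" where
  "agm_seq x y 0 = (x, y)"
| "agm_seq x y (Suc n) =
    (let (a, b) = agm_seq x y n in ((a + b) / 2, sqrt (a * b)))"

definition agm :: "real \<Rightarrow> real \<Rightarrow> real" where
  "agm x y = (THE l. (\<lambda>n. fst (agm_seq x y n)) \<longlonglongrightarrow> l \<and> (\<lambda>n. snd (agm_seq x y n)) \<longlonglongrightarrow> l)"

definition compatible_on :: "'a set \<Rightarrow> ('a \<Rightarrow> 'a \<Rightarrow> 'a) \<Rightarrow> ('a \<Rightarrow> 'a \<Rightarrow> 'a) \<Rightarrow> bool" where
  "compatible_on S m f \<longleftrightarrow> (\<forall>x\<in>S. \<forall>y\<in>S. f (m x y) (m x y) = f x y)"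

lemma agm_seq_pos:
  assumes "x > 0" "y > 0"
  shows "fst (agm_seq x y n) > 0" "snd (agm_seq x y n) > 0"
  using assms by (induction n) (auto simp: case_prod_beta)

lemma agm_seq_le:
  assumes "x > 0" "y > 0"
  shows "snd (agm_seq x y (Suc n)) \<le> fst (agm_seq x y (Suc n))"
  using agm_seq_pos[OF assms, of n] arith_geo_mean_sqrt[of "fst (agm_seq x y n)" "snd (agm_seq x y n)"]
  by (simp add: case_prod_beta)

lemma agm_limits:
  assumes "x > 0" "y > 0"
  shows agm_tendsto_fst: "(\<lambda>n. fst (agm_seq x y n)) \<longlonglongrightarrow> agm x y"
    and agm_tendsto_snd: "(\<lambda>n. snd (agm_seq x y n)) \<longlonglongrightarrow> agm x y"
    and agm_pos: "agm x y > 0"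
proof -
  define a where "a n = fst (agm_seq x y (Suc n))" for n
  define b where "b n = snd (agm_seq x y (Suc n))" for n
  have pos: "a n > 0" "b n > 0" for n
    unfolding a_def b_def by (rule agm_seq_pos[OF assms])+
  have le: "b n \<le> a n" for n
    unfolding a_def b_def by (rule agm_seq_le[OF assms])
  have a_Suc: "a (Suc n) = (a n + b n) / 2" and b_Suc: "b (Suc n) = sqrt (a n * b n)" for n
    unfolding a_def b_def agm_seq.simps(2)[of x y "Suc n"] by (simp_all only: case_prod_beta Let_def fst_conv snd_conv)
  have dec: "decseq a"
    using le by (intro decseq_SucI) (simp add: a_Suc)
  have b_mono: "b n \<le> b (Suc n)" for n
  proof -
    have "(b n)\<^sup>2 \<le> a n * b n"
      using pos(2)[of n] le[of n] by (simp add: power2_eq_square mult_right_mono)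
    then show ?thesis
      by (simp add: b_Suc real_le_rsqrt)
  qed
  obtain l where l: "a \<longlonglongrightarrow> l" and lb: "\<forall>n. l \<le> a n"
    using decseq_convergent[OF dec, of 0] pos(1) less_imp_le by metis
  have "(\<lambda>n. 2 * a (Suc n) - a n) \<longlonglongrightarrow> 2 * l - l"
    by (intro tendsto_intros l LIMSEQ_Suc[OF l])
  moreover have "2 * a (Suc n) - a n = b n" for n
    by (simp add: a_Suc field_simps)
  ultimately have lb': "b \<longlonglongrightarrow> l"
    by simp
  have "b 0 \<le> l"
    using lb' b_mono incseq_SucI incseq_le by metis
  then have lpos: "l > 0"
    using pos(2)[of 0] by linarith
  have 1: "(\<lambda>n. fst (agm_seq x y n)) \<longlonglongrightarrow> l"
    by (rule LIMSEQ_imp_Suc) (use l in \<open>simp only: a_def[abs_def]\<close>)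
  have 2: "(\<lambda>n. snd (agm_seq x y n)) \<longlonglongrightarrow> l"
    by (rule LIMSEQ_imp_Suc) (use lb' in \<open>simp only: b_def[abs_def]\<close>)
  have "agm x y = l"
    unfolding agm_def using 1 2 LIMSEQ_unique by (intro the_equality) blast+
  with 1 2 lpos show "(\<lambda>n. fst (agm_seq x y n)) \<longlonglongrightarrow> agm x y"
    "(\<lambda>n. snd (agm_seq x y n)) \<longlonglongrightarrow> agm x y" "agm x y > 0"
    by simp_all
qed

end

theory Submission imports Defs begin

text \<open>
  Since the mean is symmetric, a compatible group is commutative. Its squaring map is injective: if
  \<open>u < v\<close> had equal squares, then writing \<open>v\<close> as the mean of \<open>u\<close> and some \<open>y\<close> would give
  \<open>u * y = v * v = u * u\<close>, so \<open>y = u\<close> and \<open>v = u\<close>. In a commutative group with injective squaring,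
  compatibility forces the mean to be self-distributive, because both sides have the fourth power
  \<open>x * y * z * z\<close>. But the arithmetic-geometric mean is not self-distributive: at
  \<open>1, 10^6, 10^4\<close> the two sides are roughly 43500 and 62800, so crude bounds separate them.
\<close>

section \<open>Symmetry, monotonicity and homogeneity of the mean\<close>

text \<open>The recursion peels off the last step; here the first one is peeled off, so that
  \<open>agm_step\<close> can compare limits.\<close>

lemma agm_seq_Suc_shift: "agm_seq x y (Suc n) = agm_seq ((x + y) / 2) (sqrt (x * y)) n"
  by (induction n) (simp_all add: case_prod_beta)

lemma agm_step:
  assumes "x > 0" "y > 0"
  shows "agm x y = agm ((x + y) / 2) (sqrt (x * y))"
proof -
  have "(\<lambda>n. fst (agm_seq x y (Suc n))) \<longlonglongrightarrow> agm x y"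
    by (rule LIMSEQ_Suc[OF agm_tendsto_fst[OF assms]])
  moreover have "(\<lambda>n. fst (agm_seq x y (Suc n))) \<longlonglongrightarrow> agm ((x + y) / 2) (sqrt (x * y))"
    unfolding agm_seq_Suc_shift using assms by (intro agm_tendsto_fst) auto
  ultimately show ?thesis
    by (rule LIMSEQ_unique)
qed

text \<open>A single step is symmetric in its arguments, so both orders continue from the same
  pair.\<close>

lemma agm_commute:
  assumes "x > 0" "y > 0"
  shows "agm x y = agm y x"
  using agm_step[OF assms] agm_step[OF assms(2,1)] by (simp add: add.commute mult.commute)

lemma agm_idem:
  assumes "x > 0"
  shows "agm x x = x"
proof -
  have "agm_seq x x n = (x, x)" for n
    using assms by (induction n) simp_all
  then show ?thesis
    using agm_tendsto_fst[OF assms assms] by (simp add: LIMSEQ_const_iff)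
qed

lemma agm_seq_mono:
  assumes "0 < x" "0 < y" "x \<le> x'" "y \<le> y'"
  shows "fst (agm_seq x y n) \<le> fst (agm_seq x' y' n) \<and> snd (agm_seq x y n) \<le> snd (agm_seq x' y' n)"
proof (induction n)
  case (Suc n)
  have "0 < fst (agm_seq x y n)" "0 < snd (agm_seq x y n)"
    by (rule agm_seq_pos[OF assms(1,2)])+
  with Suc show ?case
    by (auto simp: case_prod_beta intro!: mult_mono)
qed (use assms in simp)

lemma agm_mono:
  assumes "0 < x" "0 < y" "x \<le> x'" "y \<le> y'"
  shows "agm x y \<le> agm x' y'"
proof (rule LIMSEQ_le)
  show "(\<lambda>n. fst (agm_seq x y n)) \<longlonglongrightarrow> agm x y" "(\<lambda>n. fst (agm_seq x' y' n)) \<longlonglongrightarrow> agm x' y'"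
    using assms by (auto intro: agm_tendsto_fst)
qed (use agm_seq_mono[OF assms] in blast)

lemma agm_scale:
  assumes "0 < k" "0 < x" "0 < y"
  shows "agm (k * x) (k * y) = k * agm x y"
proof -
  have seq: "agm_seq (k * x) (k * y) n = (k * fst (agm_seq x y n), k * snd (agm_seq x y n))" for n
  proof (induction n)
    case (Suc n)
    \<comment> \<open>In this form the factor leaves the square root as \<open>k\<close>.\<close>
    have "k * a * (k * b) = k\<^sup>2 * (a * b)" for a b
      by (simp add: power2_eq_square)
    with Suc assms(1) show ?case
      by (simp add: case_prod_beta real_sqrt_mult distrib_left)
  qed simp
  have "(\<lambda>n. fst (agm_seq (k * x) (k * y) n)) \<longlonglongrightarrow> agm (k * x) (k * y)"
    using assms by (intro agm_tendsto_fst) auto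
  moreover have "(\<lambda>n. fst (agm_seq (k * x) (k * y) n)) \<longlonglongrightarrow> k * agm x y"
    unfolding seq fst_conv using assms by (intro tendsto_mult_left agm_tendsto_fst)
  ultimately show ?thesis
    by (rule LIMSEQ_unique)
qed

text \<open>Together with \<open>agm_le_step\<close>, this replaces one step by rounded values.
  Squaring the condition on the geometric mean removes the root, so numerals can be checked by
  \<open>simp\<close>.\<close>

lemma agm_ge_step:
  assumes "0 < a'" "0 < b'" "0 < a" "0 < b" "2 * a' \<le> a + b" "b'\<^sup>2 \<le> a * b"
  shows "agm a' b' \<le> agm a b"
  unfolding agm_step[OF assms(3,4)] using assms by (intro agm_mono) (auto intro: real_le_rsqrt)

lemma agm_le_step:
  assumes "0 < a" "0 < b" "0 < b'" "a + b \<le> 2 * a'" "a * b \<le> b'\<^sup>2"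
  shows "agm a b \<le> agm a' b'"
  unfolding agm_step[OF assms(1,2)] using assms by (intro agm_mono) (auto intro: real_le_lsqrt)

lemma agm_ge:
  assumes "0 < c" "c \<le> a" "c \<le> b"
  shows "c \<le> agm a b"
  using agm_mono[of c c a b] assms by (simp add: agm_idem)

lemma agm_le:
  assumes "0 < a" "0 < b" "a \<le> c" "b \<le> c"
  shows "agm a b \<le> c"
  using agm_mono[of a b c c] assms by (simp add: agm_idem)

text \<open>Homogeneity and monotonicity squeeze \<open>agm u y\<close> between the multiples of \<open>agm u z\<close> by
  the factors \<open>min 1 (y / z)\<close> and \<open>max 1 (y / z)\<close>.\<close>

lemma isCont_agm:
  assumes "0 < u" "0 < z"
  shows "isCont (agm u) z"
proof -
  have low: "min 1 (y / z) * agm u z \<le> agm u y" and up: "agm u y \<le> max 1 (y / z) * agm u z"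
    if "0 < y" for y
  proof -
    have "min 1 (y / z) * u \<le> u" "u \<le> max 1 (y / z) * u"
      using assms by (simp_all add: mult_le_cancel_right1 mult_le_cancel_right2)
    moreover have "min 1 (y / z) * z \<le> y" "y \<le> max 1 (y / z) * z"
      using assms by (auto simp: min_def max_def field_simps)
    moreover have "0 < min 1 (y / z)" "0 < max 1 (y / z)"
      using that assms by (auto simp: less_max_iff_disj)
    ultimately show "min 1 (y / z) * agm u z \<le> agm u y" "agm u y \<le> max 1 (y / z) * agm u z"
      using assms that by (simp_all flip: agm_scale add: agm_mono)
  qed
  have ev: "\<forall>\<^sub>F y in at z. 0 < y"
    using order_tendstoD(1)[OF tendsto_ident_at assms(2)] .
  have "((\<lambda>y. min 1 (y / z) * agm u z) \<longlongrightarrow> min 1 (z / z) * agm u z) (at z)"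
    and "((\<lambda>y. max 1 (y / z) * agm u z) \<longlongrightarrow> max 1 (z / z) * agm u z) (at z)"
    using assms by (intro tendsto_intros; simp)+
  then have lim: "((\<lambda>y. min 1 (y / z) * agm u z) \<longlongrightarrow> agm u z) (at z)"
    "((\<lambda>y. max 1 (y / z) * agm u z) \<longlongrightarrow> agm u z) (at z)"
    using assms by simp_all
  have "\<forall>\<^sub>F y in at z. min 1 (y / z) * agm u z \<le> agm u y"
    and "\<forall>\<^sub>F y in at z. agm u y \<le> max 1 (y / z) * agm u z"
    using ev low up by (auto elim!: eventually_mono)
  then show ?thesis
    unfolding isCont_def using lim by (rule tendsto_sandwich)
qed

text \<open>Intermediate value theorem on the interval from \<open>u\<close>, where the mean is
  \<open>u\<close>, to \<open>v\<^sup>2 / u\<close>, where the mean is at least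
  \<open>v\<close>.\<close>

lemma agm_attains:
  assumes "0 < u" "u \<le> v"
  obtains y where "0 < y" "agm u y = v"
proof -
  have "u * u \<le> v * v"
    using assms by (intro mult_mono) auto
  then have le: "u \<le> v\<^sup>2 / u"
    using assms by (simp add: field_simps power2_eq_square)
  \<comment> \<open>The geometric mean of \<open>u\<close> and \<open>v\<^sup>2 / u\<close> is
    exactly \<open>v\<close>; this square shows that the arithmetic mean is at least
    \<open>v\<close>.\<close>
  have "0 \<le> (u - v)\<^sup>2"
    by simp
  then have "2 * v \<le> u + v\<^sup>2 / u"
    using assms(1) by (simp add: field_simps power2_eq_square)
  then have "agm v v \<le> agm u (v\<^sup>2 / u)"
    using assms by (intro agm_ge_step) auto
  then have "v \<le> agm u (v\<^sup>2 / u)"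
    using assms by (simp add: agm_idem)
  moreover have "agm u u \<le> v"
    using assms by (simp add: agm_idem)
  moreover have "\<forall>y. u \<le> y \<and> y \<le> v\<^sup>2 / u \<longrightarrow> isCont (agm u) y"
    using assms by (auto intro: isCont_agm)
  ultimately obtain y where "u \<le> y" "agm u y = v"
    using IVT[of "agm u" u v "v\<^sup>2 / u"] le by blast
  with assms show ?thesis
    by (intro that) auto
qed

section \<open>Groups compatible with a mean\<close>

lemma (in group) comm_group_if_compatible_symmetric:
  assumes "compatible_on (carrier G) m (\<otimes>)"
    and "\<And>x y. x \<in> carrier G \<Longrightarrow> y \<in> carrier G \<Longrightarrow> m x y = m y x"
  shows "comm_group G"
proof (rule group_comm_groupI)
  fix x y
  assume xy: "x \<in> carrier G" "y \<in> carrier G"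
  then have "x \<otimes> y = m x y \<otimes> m x y" "y \<otimes> x = m y x \<otimes> m y x"
    using assms(1) by (simp_all add: compatible_on_def)
  with assms(2)[OF xy] show "x \<otimes> y = y \<otimes> x"
    by simp
qed

lemma (in comm_group) compatible_self_distributive:
  assumes comp: "compatible_on (carrier G) m (\<otimes>)"
    and closed: "\<And>x y. x \<in> carrier G \<Longrightarrow> y \<in> carrier G \<Longrightarrow> m x y \<in> carrier G"
    and inj: "inj_on (\<lambda>x. x \<otimes> x) (carrier G)"
    and carr: "x \<in> carrier G" "y \<in> carrier G" "z \<in> carrier G"
  shows "m (m x y) z = m (m x z) (m y z)"
proof -
  have sq: "m a b \<otimes> m a b = a \<otimes> b" if "a \<in> carrier G" "b \<in> carrier G" for a b
    using comp that by (simp add: compatible_on_def)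
  \<comment> \<open>Commutativity makes squaring a homomorphism.\<close>
  have dist: "(a \<otimes> b) \<otimes> (a \<otimes> b) = (a \<otimes> a) \<otimes> (b \<otimes> b)" if "a \<in> carrier G" "b \<in> carrier G" for a b
    using that by (simp add: m_ac)
  note mem = carr closed
  have "(m x y \<otimes> z) \<otimes> (m x y \<otimes> z) = (x \<otimes> y) \<otimes> (z \<otimes> z)"
    using mem dist[of "m x y" z] sq[of x y] by simp
  also have "\<dots> = (x \<otimes> z) \<otimes> (y \<otimes> z)"
    using mem by (simp add: m_ac)
  also have "\<dots> = (m x z \<otimes> m y z) \<otimes> (m x z \<otimes> m y z)"
    using mem dist[of "m x z" "m y z"] sq[of x z] sq[of y z] by simp
  finally have "m x y \<otimes> z = m x z \<otimes> m y z"
    using inj mem by (auto dest: inj_onD)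
  \<comment> \<open>By compatibility the two equal products are the squares of the two sides of the
    goal, so injectivity applies a second time.\<close>
  then have "m (m x y) z \<otimes> m (m x y) z = m (m x z) (m y z) \<otimes> m (m x z) (m y z)"
    using mem by (simp add: sq)
  then show ?thesis
    using inj mem by (auto dest: inj_onD)
qed

lemma inj_on_square_if_compatible_agm:
  fixes G :: "real monoid" (structure)
  assumes "group G" and carr: "carrier G = {0<..}" and comp: "compatible_on {0<..} agm (\<otimes>)"
  shows "inj_on (\<lambda>x. x \<otimes> x) (carrier G)"
proof (rule linorder_inj_onI)
  interpret group G by fact
  fix u v
  assume uv: "u < v" "u \<in> carrier G" "v \<in> carrier G"
  then obtain y where y: "0 < y" "agm u y = v"
    using agm_attains[of u v] carr by auto
  show "u \<otimes> u \<noteq> v \<otimes> v"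
  proof
    assume "u \<otimes> u = v \<otimes> v"
    also have "\<dots> = u \<otimes> y"
      using comp y uv carr by (auto simp: compatible_on_def)
    \<comment> \<open>Cancelling \<open>u\<close> on the left.\<close>
    finally have "u = y"
      using uv y carr by simp
    with y uv carr show False
      by (simp add: agm_idem)
  qed
qed auto

section \<open>Numerical failure of self-distributivity\<close>

lemma agm_not_self_distributive:
  "agm (agm 1 1000000) 10000 < agm (agm 1 10000) (agm 1000000 10000)"
proof -
  \<comment> \<open>Upper bounds: each line takes one step and rounds up to integers where needed,
    until the larger entry is a good enough bound.\<close>
  have "agm 1 1000000 \<le> agm 500001 1000"
    by (rule agm_le_step) simp_all
  also have "\<dots> \<le> agm 250501 22361"
    by (rule agm_le_step) simp_all
  also have "\<dots> \<le> agm 136431 74843"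
    by (rule agm_le_step) simp_all
  also have "\<dots> \<le> agm 105637 101050"
    by (rule agm_le_step) simp_all
  also have "\<dots> \<le> 105637"
    by (rule agm_le) simp_all
  finally have "agm (agm 1 1000000) 10000 \<le> agm 105637 10000"
    by (intro agm_mono agm_pos) simp_all
  also have "\<dots> \<le> agm 57819 32502"
    by (rule agm_le_step) simp_all
  also have "\<dots> \<le> 57819"
    by (rule agm_le) simp_all
  also have "\<dots> < 60000"
    by simp
  \<comment> \<open>Lower bounds, rounded down. The chain is read backwards: each pair lies below
    one step of the pair on its right.\<close>
  also have "60000 \<le> agm 75300 50000"
    using agm_ge_step[of 60000 60000 75300 50000] by (simp add: agm_idem)
  also have "\<dots> \<le> agm 131000 19600"
    by (rule agm_ge_step) simp_all
  also have "\<dots> \<le> agm 1478 260700"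
    by (rule agm_ge_step) simp_all
  \<comment> \<open>The two inner means are bounded separately and combined by monotonicity.\<close>
  also have "\<dots> \<le> agm (agm 1 10000) (agm 1000000 10000)"
  proof (rule agm_mono)
    have "1478 \<le> agm 1485 1478"
      by (rule agm_ge) simp_all
    also have "\<dots> \<le> agm 1628 1342"
      by (rule agm_ge_step) simp_all
    also have "\<dots> \<le> agm 2550 707"
      by (rule agm_ge_step) simp_all
    also have "\<dots> \<le> agm 5000 100"
      by (rule agm_ge_step) simp_all
    also have "\<dots> \<le> agm 1 10000"
      by (rule agm_ge_step) simp_all
    finally show "1478 \<le> agm 1 10000" .
    have "260700 \<le> agm 263600 260700"
      by (rule agm_ge) simp_all
    also have "\<dots> \<le> agm 302500 224722"
      by (rule agm_ge_step) simp_all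
    also have "\<dots> \<le> agm 505000 100000"
      by (rule agm_ge_step) simp_all
    also have "\<dots> \<le> agm 1000000 10000"
      by (rule agm_ge_step) simp_all
    finally show "260700 \<le> agm 1000000 10000" .
  qed simp_all
  finally show ?thesis .
qed

theorem corollary1:
  "\<not> (\<exists>G :: real monoid. group G \<and> carrier G = {0<..} \<and>
        compatible_on {0<..} agm (\<lambda>x y. x \<otimes>\<^bsub>G\<^esub> y))"
proof
  assume "\<exists>G :: real monoid. group G \<and> carrier G = {0<..} \<and>
        compatible_on {0<..} agm (\<lambda>x y. x \<otimes>\<^bsub>G\<^esub> y)"
  then obtain G :: "real monoid"
    where G: "group G" and carr: "carrier G = {0<..}"
      and comp: "compatible_on {0<..} agm (\<lambda>x y. x \<otimes>\<^bsub>G\<^esub> y)"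
    by blast
  interpret group G
    by fact
  interpret comm_group G
    using comp carr
    by (intro comm_group_if_compatible_symmetric[where m = agm]) (auto intro: agm_commute)
  have "agm (agm 1 1000000) 10000 = agm (agm 1 10000) (agm 1000000 10000)"
  proof (rule compatible_self_distributive)
    show "inj_on (\<lambda>x. x \<otimes>\<^bsub>G\<^esub> x) (carrier G)"
      by (rule inj_on_square_if_compatible_agm[OF G carr comp])
  qed (use comp carr in \<open>auto intro: agm_pos\<close>)
  with agm_not_self_distributive show False
    by simp
qed

end
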